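(* Let $G$ and $H$ be two nontrivial connected graphs. (1) If both $G$ and $H$ are complete, then $pvc(G\square H)=1$; otherwise $pvc(G\square H)=2$. (2) If $G$ and $H$ are two complete graphs each of order at least $3$, then $pvc_2(G\square H)=1$; otherwise $pvc_2(G\square H)=2$. (3) If both $G$ and $H$ are complete, then $spvc(G\square H)=1$; otherwise $spvc(G\square H)\leq \min\{spvc(G)\cdot\chi(H),\ spvc(H)\cdot\chi(G)\}$, where $\chi$ denotes the chromatic number.
   Context: All graphs are simple, finite and undirected; nontrivial means having at least two vertices. The Cartesian product $G\square H$ has vertex set $V(G)\times V(H)$, with $(g,h)$ adjacent to $(g',h')$ iff either $g=g'$ and $hh'\in E(H)$, or $h=h'$ and $gg'\in E(G)$. A set of paths between two vertices is called disjoint if they are internally vertex-disjoint. In a vertex-colored graph, a path is vertex-proper if any two adjacent internal vertices of the path receive different colors. A vertex-colored graph is proper vertex $k$-connected if any two vertices are joined by $k$ disjoint vertex-proper paths. For a $k$-connected graph $G$, $pvc_k(G)$ is the smallest number of colors in a vertex-coloring making $G$ proper vertex $k$-connected; $pvc(G)=pvc_1(G)$, with $pvc(G)=0$ for complete $G$ (for $k\ge2$, $pvc_k(G)\ge 1$). A $u$-$v$ geodesic is a $u$-$v$ path of length $d(u,v)$. A vertex-colored graph is strong proper vertex-connected if for any two vertices $u,v$ there is a vertex-proper $u$-$v$ geodesic; $spvc(G)$ is the smallest number of colors needed for this, with $spvc(G)=0$ for complete $G$.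
   Formalization: In (3), spvc of a complete factor counts as 1 rather than 0 inside the minimum: if exactly one of G, H is complete the printed bound is 0, but spvc(G□H) ≥ 1 (e.g. G=K_2, H=P_3). For non-complete factors nothing changes. *)

theory Defs
  imports "Graph_Theory.Vertex_Walk" "Graph_Theory.Kuratowski"
begin

text \<open>
  Simple finite undirected graphs are the symmetric loop-free digraphs of the locale
  \<open>pair_graph\<close>; each edge is represented by its two orientations.
\<close>

definition complete_graph :: "'a pair_pre_digraph \<Rightarrow> bool" where
  "complete_graph G \<longleftrightarrow> (\<exists>n. complete_digraph n (with_proj G))"

definition cartesian_product ::
  "'a pair_pre_digraph \<Rightarrow> 'b pair_pre_digraph \<Rightarrow> ('a \<times> 'b) pair_pre_digraph"
  (infixr \<open>\<box>\<close> 80) where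
  "G \<box> H =
     \<lparr> pverts = pverts G \<times> pverts H,
       parcs = {((g, h), (g', h')) | g h g' h'.
                  g = g' \<and> g \<in> pverts G \<and> (h, h') \<in> parcs H \<or>
                  h = h' \<and> h \<in> pverts H \<and> (g, g') \<in> parcs G} \<rparr>"

definition path_between :: "'a pair_pre_digraph \<Rightarrow> 'a \<Rightarrow> 'a list \<Rightarrow> 'a \<Rightarrow> bool" where
  "path_between G u p v \<longleftrightarrow> vpath p (with_proj G) \<and> hd p = u \<and> last p = v"

definition internal_vertices :: "'a list \<Rightarrow> 'a list" where
  "internal_vertices p = butlast (tl p)"

definition distance :: "'a pair_pre_digraph \<Rightarrow> 'a \<Rightarrow> 'a \<Rightarrow> nat" where
  "distance G u v = (LEAST n. \<exists>p. path_between G u p v \<and> vwalk_length p = n)"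

definition geodesic :: "'a pair_pre_digraph \<Rightarrow> 'a \<Rightarrow> 'a list \<Rightarrow> 'a \<Rightarrow> bool" where
  "geodesic G u p v \<longleftrightarrow> path_between G u p v \<and> vwalk_length p = distance G u v"

definition vertex_proper :: "('a \<Rightarrow> nat) \<Rightarrow> 'a list \<Rightarrow> bool" where
  "vertex_proper c p \<longleftrightarrow> distinct_adj (map c (internal_vertices p))"

definition internally_disjoint :: "'a list \<Rightarrow> 'a list \<Rightarrow> bool" where
  "internally_disjoint p q \<longleftrightarrow> set (internal_vertices p) \<inter> set (internal_vertices q) = {}"

definition proper_vertex_k_connected ::
  "nat \<Rightarrow> 'a pair_pre_digraph \<Rightarrow> ('a \<Rightarrow> nat) \<Rightarrow> bool" where
  "proper_vertex_k_connected k G c \<longleftrightarrow>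
     (\<forall>u\<in>pverts G. \<forall>v\<in>pverts G. u \<noteq> v \<longrightarrow>
        (\<exists>P. finite P \<and> card P = k \<and> pairwise internally_disjoint P \<and>
             (\<forall>p\<in>P. path_between G u p v \<and> vertex_proper c p)))"

definition strong_proper_vertex_connected ::
  "'a pair_pre_digraph \<Rightarrow> ('a \<Rightarrow> nat) \<Rightarrow> bool" where
  "strong_proper_vertex_connected G c \<longleftrightarrow>
     (\<forall>u\<in>pverts G. \<forall>v\<in>pverts G. u \<noteq> v \<longrightarrow>
        (\<exists>p. geodesic G u p v \<and> vertex_proper c p))"

definition proper_coloring :: "'a pair_pre_digraph \<Rightarrow> ('a \<Rightarrow> nat) \<Rightarrow> bool" where
  "proper_coloring G c \<longleftrightarrow> (\<forall>(u, v)\<in>parcs G. c u \<noteq> c v)"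

definition num_colors :: "'a pair_pre_digraph \<Rightarrow> ('a \<Rightarrow> nat) \<Rightarrow> nat" where
  "num_colors G c = card (c ` pverts G)"

text \<open>
  \<open>pvc_k k G\<close> is meaningful only when \<open>G\<close> is \<open>k\<close>-connected. If no coloring
  has the required property, the value of \<^const>\<open>Least\<close> is unspecified, so an equation
  \<open>pvc_k k G = n\<close> can only be derived together with the existence of such a coloring.
\<close>

definition pvc_k :: "nat \<Rightarrow> 'a pair_pre_digraph \<Rightarrow> nat" where
  "pvc_k k G =
     (if k = 1 \<and> complete_graph G then 0
      else LEAST n. \<exists>c. proper_vertex_k_connected k G c \<and> num_colors G c = n)"

definition pvc :: "'a pair_pre_digraph \<Rightarrow> nat" where
  "pvc G = pvc_k 1 G"

definition spvc :: "'a pair_pre_digraph \<Rightarrow> nat" where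
  "spvc G =
     (if complete_graph G then 0
      else LEAST n. \<exists>c. strong_proper_vertex_connected G c \<and> num_colors G c = n)"

definition chromatic_number :: "'a pair_pre_digraph \<Rightarrow> nat" (\<open>\<chi>\<close>) where
  "chromatic_number G = (LEAST n. \<exists>c. proper_coloring G c \<and> num_colors G c = n)"

text \<open>
  The convention \<open>spvc G = 0\<close> for complete \<open>G\<close> cannot be used inside the bound
  \<open>min (spvc G * \<chi> H) (spvc H * \<chi> G)\<close>: if exactly one factor is complete, the bound
  would be \<open>0\<close>, although \<open>G \<box> H\<close> is not complete and so needs at least one color.
  There the number of colors of a complete factor has to be read as \<open>1\<close>, that is,
  as \<open>max 1 (spvc G)\<close>. For connected non-complete graphs the maximum changes nothing.
\<close>

lemma geodesic_exists:
  assumes "pair_graph G" "connected (with_proj G)" "u \<in> pverts G" "v \<in> pverts G"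
  shows "\<exists>p. geodesic G u p v"
proof -
  interpret pair_graph G by fact
  have "u \<rightarrow>\<^sup>*\<^bsub>with_proj (mk_symmetric (with_proj G))\<^esub> v"
    using assms(2-4) by (auto simp: connected_def strongly_connected_def)
  hence "u \<rightarrow>\<^sup>*\<^bsub>with_proj G\<^esub> v"
    using reachable_mk_symmetric_eq[OF sym_arcs] by simp
  then obtain p where "path_between G u p v"
    by (auto simp: reachable_vpath_conv path_between_def)
  hence "\<exists>n p. path_between G u p v \<and> vwalk_length p = n" by blast
  from LeastI_ex[OF this] show ?thesis
    by (auto simp: geodesic_def distance_def)
qed

lemma max_1_spvc:
  assumes "pair_graph G" "connected (with_proj G)" "\<not> complete_graph G"
  shows "max 1 (spvc G) = spvc G"
proof -
  interpret pair_graph G by fact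
  have ne: "pverts G \<noteq> {}"
    using assms(2) by (auto simp: connected_def strongly_connected_def mk_symmetric_def)
  obtain c :: "'a \<Rightarrow> nat" where c: "inj_on c (pverts G)"
    using finite_imp_inj_to_nat_seg[OF pair_finite_verts] by blast
  have "vertex_proper c p" if "path_between G u p v" for u p v
  proof -
    have "distinct p" "set p \<subseteq> pverts G"
      using that by (auto simp: path_between_def vpath_def vwalk_def)
    moreover have "set (internal_vertices p) \<subseteq> set p"
      unfolding internal_vertices_def by (cases p) (auto dest: in_set_butlastD)
    ultimately have "distinct (map c (internal_vertices p))"
      using inj_on_subset[OF c]
      by (auto simp: distinct_map internal_vertices_def distinct_butlast distinct_tl)
    moreover have "distinct xs \<Longrightarrow> distinct_adj xs" for xs :: "nat list"
      by (induct xs rule: induct_list012) auto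
    ultimately show ?thesis by (simp add: vertex_proper_def)
  qed
  hence "strong_proper_vertex_connected G c"
    using geodesic_exists[OF assms(1,2)]
    by (fastforce simp: strong_proper_vertex_connected_def geodesic_def)
  hence "\<exists>n c. strong_proper_vertex_connected G c \<and> num_colors G c = n" by blast
  from LeastI_ex[OF this] obtain c' where "num_colors G c' = spvc G"
    using assms(3) by (auto simp: spvc_def)
  moreover have "num_colors G c' > 0"
    using ne pair_finite_verts by (simp add: num_colors_def card_gt_0_iff)
  ultimately show ?thesis by simp
qed

end

theory Submission
  imports Defs "HOL-Library.Nat_Bijection"
begin

text \<open>
  A connected graph has a spanning connected bipartite subgraph: colour vertices by the parity of
  their distance from a root and keep the edges between different colours. The product of two such
  subgraphs is again bipartite, so all its paths are proper for the sum of the two parities, and it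
  contains two internally disjoint paths between any two vertices. Conversely a single colour
  only admits paths of length at most two, and these do not suffice if a factor is not complete
  or, for two disjoint paths, has order two.

  For the strong version, colour \<open>(g, h)\<close> with the pair of a strong proper colour of \<open>g\<close> and
  a chromatic colour of \<open>h\<close>. A vertex-proper geodesic of \<open>G\<close> may repeat the colour of an end at
  its neighbour, which is harmless only for the first and last edge of the path; hence the steps in
  \<open>H\<close> are inserted right after the first step in \<open>G\<close>.
\<close>

section \<open>Paths and distance\<close>

text \<open>Trading the arc list for \<open>successively\<close> lets the list lemmas on append, map
  and monotonicity carry the later path arguments.\<close>

lemma vwalk_with_proj_iff:
  "vwalk p (with_proj G) \<longleftrightarrow>
     p \<noteq> [] \<and> set p \<subseteq> pverts G \<and> successively (\<lambda>x y. (x, y) \<in> parcs G) p"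
proof -
  have "set (vwalk_arcs p) \<subseteq> parcs G \<longleftrightarrow> successively (\<lambda>x y. (x, y) \<in> parcs G) p"
    by (induct p rule: vwalk_arcs.induct) auto
  thus ?thesis by (auto simp: vwalk_def)
qed

lemma path_between_iff:
  "path_between G u p v \<longleftrightarrow>
     p \<noteq> [] \<and> set p \<subseteq> pverts G \<and> successively (\<lambda>x y. (x, y) \<in> parcs G) p \<and>
     distinct p \<and> hd p = u \<and> last p = v"
  by (auto simp: path_between_def vpath_def vwalk_with_proj_iff)

lemma path_between_nontrivialE:
  assumes "path_between G u p v" "u \<noteq> v"
  obtains x q where "p = u # x # q"
proof (cases p)
  case (Cons a q)
  thus ?thesis using assms that by (cases q) (auto simp: path_between_iff)
qed (use assms in \<open>auto simp: path_between_iff\<close>)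

text \<open>With a single colour, only paths with at most one internal vertex are vertex-proper. The
  lower bounds on the number of colours therefore exclude these two shapes.\<close>

lemma path_between_short:
  assumes "path_between G u p v" "u \<noteq> v" "length p \<le> 3"
  shows "p = [u, v] \<or> (\<exists>w. p = [u, w, v])"
proof -
  obtain x q where p: "p = u # x # q" by (rule path_between_nontrivialE[OF assms(1,2)])
  show ?thesis
  proof (cases q)
    case Nil thus ?thesis using assms p by (auto simp: path_between_iff)
  next
    case (Cons y r)
    thus ?thesis using assms p by (auto simp: path_between_iff)
  qed
qed

lemma length_vwalk_to_vpath: "length (vwalk_to_vpath p) \<le> length p"
proof (induct p rule: vwalk_to_vpath.induct)
  case (2 x xs)
  thus ?case using length_dropWhile_le[of "\<lambda>y. y \<noteq> x" xs] by auto
qed simp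

lemma distance_le_path: "path_between G u p v \<Longrightarrow> distance G u v \<le> length p - 1"
  unfolding distance_def by (rule Least_le) auto

text \<open>Distance minimises over paths only. Cutting the cycles out of a walk never lengthens it,
  so walks give upper bounds without a check of distinctness.\<close>

lemma distance_le_vwalk:
  assumes "vwalk p (with_proj G)"
  shows "distance G (hd p) (last p) \<le> length p - 1"
proof -
  have "path_between G (hd p) (vwalk_to_vpath p) (last p)"
    using vwalk_to_vpath_vpath[OF assms]
    by (simp add: path_between_def vwalk_to_vpath_hd vwalk_to_vpath_last)
  from distance_le_path[OF this] length_vwalk_to_vpath[of p] show ?thesis by linarith
qed

lemma path_between_imp_geodesic:
  assumes "path_between G u p v"
  obtains q where "geodesic G u q v"
proof -
  have "\<exists>n p. path_between G u p v \<and> vwalk_length p = n" using assms by blast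
  from LeastI_ex[OF this] show ?thesis
    using that by (auto simp: geodesic_def distance_def)
qed

lemma distance_Cons_le:
  assumes "pair_graph G" "connected (with_proj G)" "(u, w) \<in> parcs G" "v \<in> pverts G"
  shows "distance G u v \<le> Suc (distance G w v)"
proof -
  interpret pair_graph G by fact
  have uw: "u \<in> pverts G" "w \<in> pverts G"
    using assms(3) by (auto dest: in_arcsD1 in_arcsD2)
  obtain p where p: "geodesic G w p v" using geodesic_exists[OF assms(1,2) uw(2) assms(4)] ..
  \<comment> \<open>The vertex \<open>u\<close> may already lie on \<open>p\<close>, so the extended
    list is only claimed to be a walk.\<close>
  hence "vwalk (u # p) (with_proj G)"
    using assms(3) uw
    by (auto simp: geodesic_def path_between_iff vwalk_with_proj_iff successively_Cons)
  from distance_le_vwalk[OF this] p show ?thesis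
    by (auto simp: geodesic_def path_between_iff neq_Nil_conv)
qed

lemma distance_snoc_le:
  assumes "pair_graph G" "connected (with_proj G)" "(w, v) \<in> parcs G" "u \<in> pverts G"
  shows "distance G u v \<le> Suc (distance G u w)"
proof -
  interpret pair_graph G by fact
  have uw: "v \<in> pverts G" "w \<in> pverts G"
    using assms(3) by (auto dest: in_arcsD1 in_arcsD2)
  obtain p where p: "geodesic G u p w" using geodesic_exists[OF assms(1,2) assms(4) uw(2)] ..
  hence "vwalk (p @ [v]) (with_proj G)"
    using assms(3) uw
    by (auto simp: geodesic_def path_between_iff vwalk_with_proj_iff successively_append_iff)
  from distance_le_vwalk[OF this] p show ?thesis
    by (auto simp: geodesic_def path_between_iff neq_Nil_conv)
qed

section \<open>Internal vertices and vertex-proper paths\<close>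

text \<open>\<open>internal_vertices\<close> cuts by position, but a path repeats no vertex, so
  nothing besides the ends is lost. Disjointness of paths thus becomes a question about
  sets.\<close>

lemma set_internal_vertices:
  assumes "path_between G u p v"
  shows "set (internal_vertices p) = set p - {u, v}"
proof (cases p)
  case (Cons a q)
  thus ?thesis using assms
    by (cases q rule: rev_cases) (auto simp: internal_vertices_def path_between_iff)
qed (use assms in \<open>auto simp: path_between_iff\<close>)

lemma internal_vertices_map: "internal_vertices (map f p) = map f (internal_vertices p)"
  by (simp add: internal_vertices_def map_tl map_butlast)

lemma set_internal_vertices_subset: "set (internal_vertices p) \<subseteq> set p"
  unfolding internal_vertices_def by (cases p) (auto dest: in_set_butlastD)

lemma internally_disjoint_commute: "internally_disjoint p q \<longleftrightarrow> internally_disjoint q p"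
  by (auto simp: internally_disjoint_def)

lemma distinct_adj_butlast: "distinct_adj xs \<Longrightarrow> distinct_adj (butlast xs)"
  by (cases xs rule: rev_cases) auto

lemma distinct_adj_tl: "distinct_adj xs \<Longrightarrow> distinct_adj (tl xs)"
  by (cases xs) (auto dest: distinct_adj_ConsD)

lemma vertex_proper_if_distinct_adj:
  "distinct_adj (map c p) \<Longrightarrow> vertex_proper c p"
  unfolding vertex_proper_def internal_vertices_def map_butlast map_tl
  by (intro distinct_adj_butlast distinct_adj_tl)

text \<open>Three vertices leave at most one internal vertex, so there are no two colours to
  compare.\<close>

lemma vertex_proper_short:
  assumes "length p \<le> 3"
  shows "vertex_proper c p"
proof -
  have "length (internal_vertices p) \<le> 1" using assms by (simp add: internal_vertices_def)
  hence "internal_vertices p = [] \<or> (\<exists>x. internal_vertices p = [x])"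
    by (cases "internal_vertices p") auto
  thus ?thesis by (auto simp: vertex_proper_def)
qed

lemma distinct_imp_distinct_adj: "distinct xs \<Longrightarrow> distinct_adj xs"
  by (induct xs rule: induct_list012) auto

text \<open>Every finite graph has an injective colouring, so for connected graphs the minimum in
  \<open>spvc\<close> is attained.\<close>

lemma vertex_proper_if_inj:
  assumes "inj_on c (pverts G)" "path_between G u p v"
  shows "vertex_proper c p"
proof (rule vertex_proper_if_distinct_adj, rule distinct_imp_distinct_adj)
  show "distinct (map c p)"
    using assms inj_on_subset by (auto simp: path_between_iff distinct_map)
qed

section \<open>Numbers of colours and the parameters defined by them\<close>

lemma num_colors_ge_2:
  assumes "finite (pverts G)" "path_between G u p v" "vertex_proper c p" "length p \<ge> 4"
  shows "2 \<le> num_colors G c"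
proof -
  have "length (internal_vertices p) \<ge> 2" using assms(4) by (simp add: internal_vertices_def)
  then obtain x y q where q: "internal_vertices p = x # y # q"
    by (metis One_nat_def Suc_1 Suc_le_length_iff)
  have "c x \<noteq> c y" using assms(3) q by (simp add: vertex_proper_def)
  moreover have "{x, y} \<subseteq> pverts G"
    using set_internal_vertices_subset[of p] q assms(2) by (auto simp: path_between_iff)
  ultimately have "card {c x, c y} = 2" "{c x, c y} \<subseteq> c ` pverts G" by auto
  thus ?thesis unfolding num_colors_def using assms(1) by (metis card_mono finite_imageI)
qed

lemma num_colors_pos:
  "finite (pverts G) \<Longrightarrow> pverts G \<noteq> {} \<Longrightarrow> 1 \<le> num_colors G c"
  by (simp add: num_colors_def Suc_le_eq card_gt_0_iff)

text \<open>Distinctness is asked for separately: a path that is a single edge has no internal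
  vertices and is internally disjoint from itself.\<close>

lemma proper_vertex_2_connectedI:
  assumes "\<And>u v. u \<in> pverts G \<Longrightarrow> v \<in> pverts G \<Longrightarrow> u \<noteq> v \<Longrightarrow>
    \<exists>p q. p \<noteq> q \<and> internally_disjoint p q \<and> path_between G u p v \<and> path_between G u q v \<and>
          vertex_proper c p \<and> vertex_proper c q"
  shows "proper_vertex_k_connected 2 G c"
  unfolding proper_vertex_k_connected_def
proof (intro ballI impI)
  fix u v assume "u \<in> pverts G" "v \<in> pverts G" "u \<noteq> v"
  from assms[OF this] obtain p q where
    "p \<noteq> q" "internally_disjoint p q" "path_between G u p v" "path_between G u q v"
    "vertex_proper c p" "vertex_proper c q" by blast
  thus "\<exists>P. finite P \<and> card P = 2 \<and> pairwise internally_disjoint P \<and>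
             (\<forall>p\<in>P. path_between G u p v \<and> vertex_proper c p)"
    by (intro exI[of _ "{p, q}"]) (auto simp: pairwise_insert internally_disjoint_commute)
qed

text \<open>Any \<open>j\<close> of the \<open>k\<close> paths remain pairwise disjoint. This lets
  one colouring bound both \<open>pvc_k 2\<close> and \<open>pvc\<close> from above.\<close>

lemma proper_vertex_k_connected_mono:
  assumes "proper_vertex_k_connected k G c" "j \<le> k"
  shows "proper_vertex_k_connected j G c"
  unfolding proper_vertex_k_connected_def
proof (intro ballI impI)
  fix u v assume "u \<in> pverts G" "v \<in> pverts G" "u \<noteq> v"
  then obtain P where P: "finite P" "card P = k" "pairwise internally_disjoint P"
    "\<forall>p\<in>P. path_between G u p v \<and> vertex_proper c p"
    using assms(1) unfolding proper_vertex_k_connected_def by metis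
  obtain Q where "Q \<subseteq> P" "card Q = j" "finite Q"
    using obtain_subset_with_card_n assms(2) P(2) by metis
  thus "\<exists>P. finite P \<and> card P = j \<and> pairwise internally_disjoint P \<and>
             (\<forall>p\<in>P. path_between G u p v \<and> vertex_proper c p)"
    using P pairwise_subset by (intro exI[of _ Q]) blast
qed

text \<open>The colouring \<open>c\<close> shows that the minimum is attained; without such a
  witness the value of \<open>LEAST\<close> would be unspecified.\<close>

lemma pvc_k_eqI:
  assumes "\<not> (k = 1 \<and> complete_graph G)"
    and "proper_vertex_k_connected k G c" "num_colors G c \<le> n"
    and "\<And>c. proper_vertex_k_connected k G c \<Longrightarrow> n \<le> num_colors G c"
  shows "pvc_k k G = n"
proof -
  have "num_colors G c = n" using assms by (simp add: le_antisym)
  hence "(LEAST n. \<exists>c. proper_vertex_k_connected k G c \<and> num_colors G c = n) = n"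
    using assms by (intro Least_equality) auto
  thus ?thesis using assms(1) by (auto simp: pvc_k_def)
qed

lemma spvc_le:
  assumes "strong_proper_vertex_connected G c"
  shows "spvc G \<le> num_colors G c"
  using assms by (auto simp: spvc_def intro!: Least_le)

text \<open>The order hidden in \<open>complete_graph\<close> is just the cardinality, and one
  inclusion of the arc sets follows from loop-freeness, so only adjacency remains.\<close>

lemma complete_graph_iff:
  assumes "pair_graph G"
  shows "complete_graph G \<longleftrightarrow> (\<forall>u\<in>pverts G. \<forall>v\<in>pverts G. u \<noteq> v \<longrightarrow> (u, v) \<in> parcs G)"
proof -
  interpret pair_graph G by fact
  have "parcs G \<subseteq> {(u, v). (u, v) \<in> pverts G \<times> pverts G \<and> u \<noteq> v}"
    using pair_no_loops in_arcsD1 in_arcsD2 by fastforce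
  thus ?thesis unfolding complete_graph_def complete_digraph_pair_def
    using pair_finite_verts by blast
qed

text \<open>For complete graphs the convention gives \<open>spvc G = 0\<close>, yet a colouring uses
  a colour; there the constant colouring matches the 1 in the maximum. Otherwise the minimum itself
  is attained.\<close>

lemma ex_strong_coloring:
  assumes "pair_graph G" "connected (with_proj G)"
  obtains c where "strong_proper_vertex_connected G c" "num_colors G c \<le> max 1 (spvc G)"
proof (cases "complete_graph G")
  case True
  interpret pair_graph G by fact
  have "\<exists>p. geodesic G u p v \<and> vertex_proper c p"
    if "u \<in> pverts G" "v \<in> pverts G" "u \<noteq> v" for u v and c :: "'a \<Rightarrow> nat"
  proof -
    have "path_between G u [u, v] v"
      using that True complete_graph_iff[OF assms(1)] by (simp add: path_between_iff)
    moreover from this obtain p where "geodesic G u p v" by (rule path_between_imp_geodesic)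
    \<comment> \<open>The edge bounds the distance by 1, so every geodesic has at most two
      vertices.\<close>
    ultimately show ?thesis
      using distance_le_path by (intro exI[of _ p]) (fastforce simp: geodesic_def intro!: vertex_proper_short)
  qed
  hence "strong_proper_vertex_connected G (\<lambda>_. 0)"
    by (simp add: strong_proper_vertex_connected_def)
  moreover have "num_colors G (\<lambda>_. 0) \<le> max 1 (spvc G)"
    by (simp add: num_colors_def image_constant_conv le_max_iff_disj)
  ultimately show ?thesis using that by blast
next
  case False
  interpret pair_graph G by fact
  obtain c :: "'a \<Rightarrow> nat" where c: "inj_on c (pverts G)"
    using finite_imp_inj_to_nat_seg[OF pair_finite_verts] by blast
  have "strong_proper_vertex_connected G c"
    unfolding strong_proper_vertex_connected_def
    using geodesic_exists[OF assms] vertex_proper_if_inj[OF c] by (metis geodesic_def)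
  hence "\<exists>n c. strong_proper_vertex_connected G c \<and> num_colors G c = n" by blast
  from LeastI_ex[OF this] False that show ?thesis by (auto simp: spvc_def)
qed

lemma ex_chromatic_coloring:
  assumes "pair_graph G"
  obtains c where "proper_coloring G c" "num_colors G c = \<chi> G"
proof -
  interpret pair_graph G by fact
  obtain c :: "'a \<Rightarrow> nat" where c: "inj_on c (pverts G)"
    using finite_imp_inj_to_nat_seg[OF pair_finite_verts] by blast
  have "proper_coloring G c"
    using inj_onD[OF c] pair_no_loops in_arcsD1 in_arcsD2
    unfolding proper_coloring_def by fastforce
  hence "\<exists>n c. proper_coloring G c \<and> num_colors G c = n" by blast
  from LeastI_ex[OF this] that show ?thesis by (auto simp: chromatic_number_def)
qed

lemma two_elements:
  assumes "card A \<ge> 2"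
  obtains x y where "x \<in> A" "y \<in> A" "x \<noteq> y"
  using assms by (metis card_2_iff' obtain_subset_with_card_n subsetD)

lemma ex_other:
  assumes "card A \<ge> 2"
  obtains y where "y \<in> A" "y \<noteq> x"
  using two_elements[OF assms] by metis

section \<open>Spanning bipartite subgraphs\<close>

text \<open>Deleting the monochromatic edges turns \<open>c\<close> into a proper colouring, so
  every path that survives is vertex-proper.\<close>

definition bichromatic_subgraph ::
  "'a pair_pre_digraph \<Rightarrow> ('a \<Rightarrow> nat) \<Rightarrow> 'a pair_pre_digraph" where
  "bichromatic_subgraph G c =
     \<lparr>pverts = pverts G, parcs = {(x, y). (x, y) \<in> parcs G \<and> c x \<noteq> c y}\<rparr>"

lemma bichromatic_subgraph_simps [simp]:
  "pverts (bichromatic_subgraph G c) = pverts G"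
  "(x, y) \<in> parcs (bichromatic_subgraph G c) \<longleftrightarrow> (x, y) \<in> parcs G \<and> c x \<noteq> c y"
  by (auto simp: bichromatic_subgraph_def)

text \<open>The last edge of a geodesic from the root joins vertices whose distances differ by one,
  hence of different parity, so it survives. Induction on the distance then connects every vertex to
  the root.\<close>

lemma ex_connected_bichromatic_subgraph:
  assumes "pair_graph G" "connected (with_proj G)"
  obtains c where "\<And>v. c v < (2 :: nat)"
    "\<And>u v. u \<in> pverts G \<Longrightarrow> v \<in> pverts G \<Longrightarrow> \<exists>p. path_between (bichromatic_subgraph G c) u p v"
proof -
  interpret pair_graph G by fact
  obtain r where r: "r \<in> pverts G"
    using assms(2) by (auto simp: connected_def strongly_connected_def mk_symmetric_def)
  define c where "c v = distance G r v mod 2" for v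
  let ?S = "bichromatic_subgraph G c"
  interpret S: pair_wf_digraph ?S
    by unfold_locales (auto dest: in_arcsD1 in_arcsD2)
  have sym: "(v, u) \<in> parcs G" if "(u, v) \<in> parcs G" for u v
    using sym_arcs that by (auto simp: symmetric_def dest: symD)
  have S_sym: "symmetric ?S" by (auto simp: symmetric_def sym intro!: symI)
  have reach: "r \<rightarrow>\<^sup>*\<^bsub>?S\<^esub> v" if "v \<in> pverts G" for v
    using that
  proof (induct "distance G r v" arbitrary: v rule: less_induct)
    case less
    obtain p where p: "geodesic G r p v" using geodesic_exists[OF assms r less.prems] ..
    show ?case
    proof (cases "r = v")
      case False
      obtain q where q: "p = q @ [v]"
        using p by (cases p rule: rev_cases) (auto simp: geodesic_def path_between_iff)
      have "q \<noteq> []" using q p False by (auto simp: geodesic_def path_between_iff)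
      hence walk: "path_between G r q (last q)" "(last q, v) \<in> parcs G"
        using p q by (auto simp: geodesic_def path_between_iff successively_append_iff)
      have "distance G r (last q) \<le> length q - 1" by (rule distance_le_path[OF walk(1)])
      moreover have "distance G r v = length q" using p q by (simp add: geodesic_def)
      moreover have "distance G r v \<le> Suc (distance G r (last q))"
        by (rule distance_snoc_le[OF assms walk(2) r])
      \<comment> \<open>The path \<open>q\<close> bounds the distance to its last vertex from above,
        the triangle inequality bounds it from below.\<close>
      ultimately have d: "distance G r v = Suc (distance G r (last q))"
        using \<open>q \<noteq> []\<close> by (cases q) auto
      have "last q \<in> pverts G" using walk(2) by (rule in_arcsD1)
      hence "r \<rightarrow>\<^sup>*\<^bsub>?S\<^esub> last q" using less.hyps d by simp
      moreover have "c (last q) \<noteq> c v" unfolding c_def d by presburger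
      hence "(last q, v) \<in> parcs ?S" using walk(2) by simp
      ultimately show ?thesis by (rule S.reachable_adj_trans)
    qed (use r in \<open>auto simp: S.reachable_refl\<close>)
  qed
  have "\<exists>p. path_between ?S u p v" if "u \<in> pverts G" "v \<in> pverts G" for u v
  proof -
    \<comment> \<open>By symmetry \<open>u\<close> reaches the root \<open>r\<close>, which reaches
      \<open>v\<close>.\<close>
    have "u \<rightarrow>\<^sup>*\<^bsub>?S\<^esub> v"
      using reach that symmetric_reachable[OF S_sym] S.reachable_trans by metis
    thus ?thesis by (auto simp: S.reachable_vpath_conv path_between_def)
  qed
  moreover have "c v < 2" for v by (simp add: c_def)
  ultimately show ?thesis using that by blast
qed

section \<open>Cartesian products\<close>

lemma cartesian_product_simps [simp]:
  "pverts (G \<box> H) = pverts G \<times> pverts H"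
  "((g, h), (g', h')) \<in> parcs (G \<box> H) \<longleftrightarrow>
     g = g' \<and> g \<in> pverts G \<and> (h, h') \<in> parcs H \<or> h = h' \<and> h \<in> pverts H \<and> (g, g') \<in> parcs G"
  by (auto simp: cartesian_product_def)

section \<open>Exchanging the two factors\<close>

lemma path_between_swap:
  assumes "path_between (G \<box> H) u p v"
  shows "path_between (H \<box> G) (prod.swap u) (map prod.swap p) (prod.swap v)"
proof -
  have "successively (\<lambda>x y. (prod.swap x, prod.swap y) \<in> parcs (H \<box> G)) p"
    using assms unfolding path_between_iff
    by (auto elim!: successively_mono)
  thus ?thesis using assms
    by (auto simp: path_between_iff successively_map distinct_map hd_map last_map)
qed

lemma internally_disjoint_map:
  "inj f \<Longrightarrow> internally_disjoint (map f p) (map f q) \<longleftrightarrow> internally_disjoint p q"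
  by (auto simp: internally_disjoint_def internal_vertices_map inj_def)

lemma vertex_proper_map: "vertex_proper c (map f p) \<longleftrightarrow> vertex_proper (c \<circ> f) p"
  by (simp add: vertex_proper_def internal_vertices_map)

lemma num_colors_swap: "num_colors (H \<box> G) (c \<circ> prod.swap) = num_colors (G \<box> H) c"
proof -
  have "(c \<circ> prod.swap) ` (pverts H \<times> pverts G) = c ` (pverts G \<times> pverts H)"
    by (metis image_comp product_swap)
  thus ?thesis by (simp add: num_colors_def)
qed

lemma proper_vertex_k_connected_swap:
  assumes "proper_vertex_k_connected k (G \<box> H) c"
  shows "proper_vertex_k_connected k (H \<box> G) (c \<circ> prod.swap)"
  unfolding proper_vertex_k_connected_def
proof (intro ballI impI)
  fix u v assume "u \<in> pverts (H \<box> G)" "v \<in> pverts (H \<box> G)" "u \<noteq> v"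
  hence "prod.swap u \<in> pverts (G \<box> H)" "prod.swap v \<in> pverts (G \<box> H)"
    "prod.swap u \<noteq> prod.swap v" by auto
  then obtain P where P: "finite P" "card P = k" "pairwise internally_disjoint P"
    "\<And>p. p \<in> P \<Longrightarrow> path_between (G \<box> H) (prod.swap u) p (prod.swap v) \<and> vertex_proper c p"
    using assms unfolding proper_vertex_k_connected_def by meson
  let ?P = "map prod.swap ` P"
  have "finite ?P" "card ?P = k"
    using P by (auto simp: card_image inj_on_def)
  moreover have "pairwise internally_disjoint ?P"
    using P(3) by (auto simp: pairwise_def internally_disjoint_map)
  moreover have "path_between (H \<box> G) u p v \<and> vertex_proper (c \<circ> prod.swap) p" if "p \<in> ?P" for p
    using that P(4) path_between_swap by (fastforce simp: vertex_proper_map comp_def)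
  ultimately show "\<exists>P. finite P \<and> card P = k \<and> pairwise internally_disjoint P \<and>
      (\<forall>p\<in>P. path_between (H \<box> G) u p v \<and> vertex_proper (c \<circ> prod.swap) p)" by blast
qed

lemma distance_swap: "distance (H \<box> G) (prod.swap u) (prod.swap v) = distance (G \<box> H) u v"
proof -
  have "(\<exists>p. path_between (H \<box> G) (prod.swap u) p (prod.swap v) \<and> vwalk_length p = n) \<longleftrightarrow>
        (\<exists>p. path_between (G \<box> H) u p v \<and> vwalk_length p = n)" for n
    using path_between_swap[of G H u _ v] path_between_swap[of H G "prod.swap u" _ "prod.swap v"]
    by (metis length_map swap_swap vwalk_length_simp)
  thus ?thesis by (simp add: distance_def)
qed

lemma strong_proper_vertex_connected_swap:
  assumes "strong_proper_vertex_connected (G \<box> H) c"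
  shows "strong_proper_vertex_connected (H \<box> G) (c \<circ> prod.swap)"
  unfolding strong_proper_vertex_connected_def
proof (intro ballI impI)
  fix u v assume "u \<in> pverts (H \<box> G)" "v \<in> pverts (H \<box> G)" "u \<noteq> v"
  hence "prod.swap u \<in> pverts (G \<box> H)" "prod.swap v \<in> pverts (G \<box> H)"
    "prod.swap u \<noteq> prod.swap v" by auto
  then obtain p where p: "geodesic (G \<box> H) (prod.swap u) p (prod.swap v)" "vertex_proper c p"
    using assms unfolding strong_proper_vertex_connected_def by meson
  have "geodesic (H \<box> G) u (map prod.swap p) v"
    using p(1) path_between_swap[of G H "prod.swap u" p "prod.swap v"]
      distance_swap[of G H u v] by (simp add: geodesic_def)
  moreover have "vertex_proper (c \<circ> prod.swap) (map prod.swap p)"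
    using p(2) by (simp add: vertex_proper_map comp_def)
  ultimately show "\<exists>p. geodesic (H \<box> G) u p v \<and> vertex_proper (c \<circ> prod.swap) p" by blast
qed

section \<open>Paths and pairs of disjoint paths in products\<close>

text \<open>These are the two L-shaped routes around the rectangle spanned by \<open>P\<close> and
  \<open>Q\<close>. The corner vertex closes the first leg, so \<open>tl\<close> drops it from the
  second.\<close>

lemma path_between_corner:
  assumes "path_between G g P g'" "path_between H h Q h'"
  shows "path_between (G \<box> H) (g, h) (map (\<lambda>x. (x, h)) P @ map (Pair g') (tl Q)) (g', h')"
    and "path_between (G \<box> H) (g, h) (map (Pair g) Q @ map (\<lambda>x. (x, h')) (tl P)) (g', h')"
proof -
  obtain P' where P: "P = g # P'" using assms(1) by (cases P) (auto simp: path_between_iff)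
  obtain Q' where Q: "Q = h # Q'" using assms(2) by (cases Q) (auto simp: path_between_iff)
  have G: "successively (\<lambda>x y. (x, y) \<in> parcs G) P" "set P \<subseteq> pverts G" "distinct P" "last P = g'" "P \<noteq> []"
    and H: "successively (\<lambda>x y. (x, y) \<in> parcs H) Q" "set Q \<subseteq> pverts H" "distinct Q" "last Q = h'" "Q \<noteq> []"
    using assms by (auto simp: path_between_iff)
  have gh: "g \<in> pverts G" "h \<in> pverts H" "g' \<in> pverts G" "h' \<in> pverts H"
    using G H P Q last_in_set[of P] last_in_set[of Q] by auto
  have "successively (\<lambda>x y. (x, y) \<in> parcs (G \<box> H)) (map (\<lambda>x. (x, k)) P)" if "k \<in> pverts H" for k
    using G(1) that by (auto simp: successively_map elim!: successively_mono)
  hence G': "successively (\<lambda>x y. (x, y) \<in> parcs (G \<box> H)) (map (\<lambda>x. (x, h)) P)"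
    "successively (\<lambda>x y. (x, y) \<in> parcs (G \<box> H)) (map (\<lambda>x. (x, h')) P)" using gh by auto
  have "successively (\<lambda>x y. (x, y) \<in> parcs (G \<box> H)) (map (Pair k) Q)" if "k \<in> pverts G" for k
    using H(1) that by (auto simp: successively_map elim!: successively_mono)
  hence H': "successively (\<lambda>x y. (x, y) \<in> parcs (G \<box> H)) (map (Pair g) Q)"
    "successively (\<lambda>x y. (x, y) \<in> parcs (G \<box> H)) (map (Pair g') Q)" using gh by auto
  have "successively (\<lambda>x y. (x, y) \<in> parcs (G \<box> H))
      (map (\<lambda>x. (x, h)) P @ map (Pair g') (tl Q))"
    using G'(1) H'(2) Q G(4) \<open>P \<noteq> []\<close>
    by (auto simp: successively_append_iff successively_Cons last_map)
  thus "path_between (G \<box> H) (g, h) (map (\<lambda>x. (x, h)) P @ map (Pair g') (tl Q)) (g', h')"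
    using P Q G H gh
    by (auto simp: path_between_iff distinct_map inj_on_def last_map)
  have "successively (\<lambda>x y. (x, y) \<in> parcs (G \<box> H))
      (map (Pair g) Q @ map (\<lambda>x. (x, h')) (tl P))"
    using G'(2) H'(1) P H(4) \<open>Q \<noteq> []\<close>
    by (auto simp: successively_append_iff successively_Cons last_map)
  thus "path_between (G \<box> H) (g, h) (map (Pair g) Q @ map (\<lambda>x. (x, h')) (tl P)) (g', h')"
    using P Q G H gh
    by (auto simp: path_between_iff distinct_map inj_on_def last_map)
qed

lemma path_between_horizontal:
  assumes "path_between G g P g'" "h \<in> pverts H"
  shows "path_between (G \<box> H) (g, h) (map (\<lambda>x. (x, h)) P) (g', h)"
  using path_between_corner(1)[OF assms(1), of H h "[h]" h] assms(2) by (simp add: path_between_iff)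

text \<open>The route steps into the parallel layer \<open>k\<close>, follows \<open>P\<close> there
  and steps back. The assumption \<open>g \<noteq> g'\<close> keeps its two vertices in layer
  \<open>h\<close> distinct.\<close>

lemma path_between_detour:
  assumes "path_between G g P g'" "g \<noteq> g'" "(h, k) \<in> parcs H" "(k, h) \<in> parcs H" "h \<noteq> k"
    and "h \<in> pverts H" "k \<in> pverts H"
  shows "path_between (G \<box> H) (g, h) ((g, h) # map (\<lambda>x. (x, k)) P @ [(g', h)]) (g', h)"
proof -
  have "path_between (G \<box> H) (g, k) (map (\<lambda>x. (x, k)) P) (g', k)"
    using assms by (intro path_between_horizontal)
  thus ?thesis using assms
    by (auto simp: path_between_iff successively_append_iff successively_Cons last_map hd_map)
qed

lemma two_paths_horizontal:
  assumes "path_between G g P g'" "g \<noteq> g'" "(h, k) \<in> parcs H" "(k, h) \<in> parcs H" "h \<noteq> k"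
    and "h \<in> pverts H" "k \<in> pverts H"
  obtains p q where "p \<noteq> q" "internally_disjoint p q"
    "path_between (G \<box> H) (g, h) p (g', h)" "path_between (G \<box> H) (g, h) q (g', h)"
proof -
  note p = path_between_horizontal[OF assms(1,6)] and q = path_between_detour[OF assms]
  show ?thesis
  proof (rule that[OF _ _ p q])
    show "internally_disjoint (map (\<lambda>x. (x, h)) P) ((g, h) # map (\<lambda>x. (x, k)) P @ [(g', h)])"
      unfolding internally_disjoint_def set_internal_vertices[OF p] set_internal_vertices[OF q]
      using assms(5) by auto
    have "(g, k) \<in> set ((g, h) # map (\<lambda>x. (x, k)) P @ [(g', h)])"
      using assms(1) by (auto simp: path_between_iff)
    moreover have "(g, k) \<notin> set (map (\<lambda>x. (x, h)) P)" using assms(5) by auto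
    ultimately show "map (\<lambda>x. (x, h)) P \<noteq> (g, h) # map (\<lambda>x. (x, k)) P @ [(g', h)]" by metis
  qed
qed

text \<open>The two L-shaped routes run on opposite sides of the rectangle and meet only at its
  corners \<open>(g, h)\<close> and \<open>(g', h')\<close>, since both coordinates differ. The
  corner at the turn is counted once in the lengths.\<close>

lemma two_paths_diagonal:
  assumes "path_between G g P g'" "g \<noteq> g'" "path_between H h Q h'" "h \<noteq> h'"
  obtains p q where "p \<noteq> q" "internally_disjoint p q"
    "path_between (G \<box> H) (g, h) p (g', h')" "path_between (G \<box> H) (g, h) q (g', h')"
    "length p = length P + length Q - 1" "length q = length P + length Q - 1"
proof -
  note p = path_between_corner(1)[OF assms(1,3)] and q = path_between_corner(2)[OF assms(1,3)]
  have ne: "P \<noteq> []" "Q \<noteq> []" and tl: "g \<notin> set (tl P)" "h \<notin> set (tl Q)"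
    using assms by (auto simp: path_between_iff neq_Nil_conv)
  show ?thesis
  proof (rule that[OF _ _ p q])
    show "internally_disjoint (map (\<lambda>x. (x, h)) P @ map (Pair g') (tl Q))
            (map (Pair g) Q @ map (\<lambda>x. (x, h')) (tl P))"
      unfolding internally_disjoint_def set_internal_vertices[OF p] set_internal_vertices[OF q]
      using assms(2,4) tl by auto
    \<comment> \<open>The turning corner of the first route tells the two lists apart.\<close>
    have "(g', h) \<in> set (map (\<lambda>x. (x, h)) P @ map (Pair g') (tl Q))"
      using assms(1) last_in_set[OF ne(1)] by (auto simp: path_between_iff)
    moreover have "(g', h) \<notin> set (map (Pair g) Q @ map (\<lambda>x. (x, h')) (tl P))"
      using assms(2,4) by auto
    ultimately show "map (\<lambda>x. (x, h)) P @ map (Pair g') (tl Q) \<noteq>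
        map (Pair g) Q @ map (\<lambda>x. (x, h')) (tl P)" by metis
  qed (use ne in \<open>auto simp: neq_Nil_conv\<close>)
qed

text \<open>The hypotheses ask for paths and symmetry instead of \<open>pair_graph\<close> and
  \<open>connected\<close>, in the form established for bichromatic subgraphs.\<close>

lemma two_paths_product:
  assumes G: "\<And>u v. u \<in> pverts G \<Longrightarrow> v \<in> pverts G \<Longrightarrow> \<exists>p. path_between G u p v"
      "sym (parcs G)" "card (pverts G) \<ge> 2"
    and H: "\<And>u v. u \<in> pverts H \<Longrightarrow> v \<in> pverts H \<Longrightarrow> \<exists>p. path_between H u p v"
      "sym (parcs H)" "card (pverts H) \<ge> 2"
    and uv: "u \<in> pverts (G \<box> H)" "v \<in> pverts (G \<box> H)" "u \<noteq> v"
  shows "\<exists>p q. p \<noteq> q \<and> internally_disjoint p q \<and>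
    path_between (G \<box> H) u p v \<and> path_between (G \<box> H) u q v"
proof -
  \<comment> \<open>The neighbour is the second vertex of a path from \<open>x\<close> to some other
    vertex; it provides the layer for the detour.\<close>
  have neighbor: "\<exists>y. (x, y) \<in> parcs K \<and> (y, x) \<in> parcs K \<and> x \<noteq> y \<and> y \<in> pverts K"
    if K: "\<And>u v. u \<in> pverts K \<Longrightarrow> v \<in> pverts K \<Longrightarrow> \<exists>p. path_between K u p v"
      "sym (parcs K)" "card (pverts K) \<ge> 2" "x \<in> pverts K" for K :: "'c pair_pre_digraph" and x
  proof -
    obtain z where z: "z \<in> pverts K" "z \<noteq> x" using K(3) by (rule ex_other)
    obtain p where p: "path_between K x p z" using K(1,4) z by blast
    obtain y q where "p = x # y # q" using path_between_nontrivialE[OF p] z by metis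
    thus ?thesis using p symD[OF K(2)] by (auto simp: path_between_iff)
  qed
  obtain g h where u: "u = (g, h)" by (cases u)
  obtain g' h' where v: "v = (g', h')" by (cases v)
  have in_verts: "g \<in> pverts G" "g' \<in> pverts G" "h \<in> pverts H" "h' \<in> pverts H"
    using uv u v by auto
  obtain P where P: "path_between G g P g'" using G(1) in_verts by blast
  obtain Q where Q: "path_between H h Q h'" using H(1) in_verts by blast
  consider "g \<noteq> g'" "h \<noteq> h'" | "g \<noteq> g'" "h = h'" | "g = g'" "h \<noteq> h'" using uv(3) u v by auto
  thus ?thesis
  proof cases
    case 1
    show ?thesis using two_paths_diagonal[OF P 1(1) Q 1(2)] unfolding u v by metis
  next
    case 2
    from neighbor[OF H in_verts(3)] obtain k where
      k: "(h, k) \<in> parcs H" "(k, h) \<in> parcs H" "h \<noteq> k" "k \<in> pverts H" by blast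
    show ?thesis
      using two_paths_horizontal[OF P 2(1) k(1-3) in_verts(3) k(4)] 2(2) unfolding u v by metis
  next
    case 3
    from neighbor[OF G in_verts(1)] obtain k where
      k: "(g, k) \<in> parcs G" "(k, g) \<in> parcs G" "g \<noteq> k" "k \<in> pverts G" by blast
    \<comment> \<open>The detour in the other direction is built in \<open>H \<box> G\<close> and
      swapped back.\<close>
    obtain p q where pq: "p \<noteq> q" "internally_disjoint p q"
      "path_between (H \<box> G) (h, g) p (h', g)" "path_between (H \<box> G) (h, g) q (h', g)"
      by (rule two_paths_horizontal[OF Q 3(2) k(1-3) in_verts(1) k(4)])
    have "map prod.swap p \<noteq> map prod.swap q" using pq(1) by (simp add: inj_map_eq_map)
    moreover have "internally_disjoint (map prod.swap p) (map prod.swap q)"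
      using pq(2) by (simp add: internally_disjoint_map)
    moreover have "path_between (G \<box> H) u (map prod.swap p) v"
      "path_between (G \<box> H) u (map prod.swap q) v"
      using path_between_swap[OF pq(3)] path_between_swap[OF pq(4)] 3(1) u v by simp_all
    ultimately show ?thesis by blast
  qed
qed

section \<open>Two-colourings of products and lower bounds\<close>

text \<open>Vertices that differ in both coordinates are never adjacent. Hence the value 0 reserved
  for complete graphs does not occur for the product.\<close>

lemma product_not_complete:
  assumes "card (pverts G) \<ge> 2" "card (pverts H) \<ge> 2"
  shows "\<not> complete_graph (G \<box> H)"
proof
  assume complete: "complete_graph (G \<box> H)"
  obtain g g' where g: "g \<in> pverts G" "g' \<in> pverts G" "g \<noteq> g'"
    using assms(1) by (rule two_elements)
  obtain h h' where h: "h \<in> pverts H" "h' \<in> pverts H" "h \<noteq> h'"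
    using assms(2) by (rule two_elements)
  have "((g, h), (g', h')) \<in> parcs (G \<box> H)"
    using complete g h unfolding complete_graph_def complete_digraph_pair_def by auto
  thus False using g h by simp
qed

lemma ex_proper_2_coloring_product:
  assumes "pair_graph G" "connected (with_proj G)" "card (pverts G) \<ge> 2"
    and "pair_graph H" "connected (with_proj H)" "card (pverts H) \<ge> 2"
  obtains c where "proper_vertex_k_connected 2 (G \<box> H) c" "num_colors (G \<box> H) c \<le> 2"
proof -
  interpret G: pair_graph G by fact
  interpret H: pair_graph H by fact
  obtain a where a: "\<And>v. a v < (2 :: nat)"
    "\<And>u v. u \<in> pverts G \<Longrightarrow> v \<in> pverts G \<Longrightarrow> \<exists>p. path_between (bichromatic_subgraph G a) u p v"
    using ex_connected_bichromatic_subgraph[OF assms(1,2)] by metis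
  obtain b where b: "\<And>v. b v < (2 :: nat)"
    "\<And>u v. u \<in> pverts H \<Longrightarrow> v \<in> pverts H \<Longrightarrow> \<exists>p. path_between (bichromatic_subgraph H b) u p v"
    using ex_connected_bichromatic_subgraph[OF assms(4,5)] by metis
  let ?S = "bichromatic_subgraph G a" and ?T = "bichromatic_subgraph H b"
  \<comment> \<open>An edge of \<open>?S \<box> ?T\<close> changes one coordinate and flips its
    parity while the other summand stays fixed, so the sum modulo 2 changes.\<close>
  define c where "c = (\<lambda>(g, h). (a g + b h) mod 2)"
  have sym: "sym (parcs ?S)" "sym (parcs ?T)"
    using G.sym_arcs H.sym_arcs by (auto simp: symmetric_def sym_def)
  have arc: "(u, v) \<in> parcs (G \<box> H) \<and> c u \<noteq> c v" if uv: "(u, v) \<in> parcs (?S \<box> ?T)" for u v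
  proof -
    have parity: "(x + y) mod 2 \<noteq> (x + z) mod 2" "(y + x) mod 2 \<noteq> (z + x) mod 2"
      if "y < 2" "z < 2" "y \<noteq> z" for x y z :: nat
      using that by (auto simp: less_2_cases_iff mod_Suc split: if_splits)
    show ?thesis using uv parity a(1) b(1)
      by (cases u, cases v) (auto simp: c_def)
  qed
  have path: "path_between (G \<box> H) u p v \<and> vertex_proper c p"
    if "path_between (?S \<box> ?T) u p v" for u p v
  proof -
    have s: "successively (\<lambda>x y. (x, y) \<in> parcs (?S \<box> ?T)) p"
      using that by (simp add: path_between_iff)
    have "successively (\<lambda>x y. (x, y) \<in> parcs (G \<box> H)) p"
      "successively (\<lambda>x y. c x \<noteq> c y) p"
      using s arc by (auto elim!: successively_mono)
    thus ?thesis using that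
      by (auto simp: path_between_iff distinct_adj_def successively_map
          intro!: vertex_proper_if_distinct_adj)
  qed
  have "proper_vertex_k_connected 2 (G \<box> H) c"
  proof (rule proper_vertex_2_connectedI)
    fix u v assume uv: "u \<in> pverts (G \<box> H)" "v \<in> pverts (G \<box> H)" "u \<noteq> v"
    have "\<exists>p q. p \<noteq> q \<and> internally_disjoint p q \<and>
        path_between (?S \<box> ?T) u p v \<and> path_between (?S \<box> ?T) u q v"
      using uv a(2) b(2) sym assms(3,6) by (intro two_paths_product) auto
    thus "\<exists>p q. p \<noteq> q \<and> internally_disjoint p q \<and> path_between (G \<box> H) u p v \<and>
        path_between (G \<box> H) u q v \<and> vertex_proper c p \<and> vertex_proper c q"
      using path by blast
  qed
  moreover have "c ` pverts (G \<box> H) \<subseteq> {..<2}" by (auto simp: c_def)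
  hence "num_colors (G \<box> H) c \<le> 2"
    unfolding num_colors_def using card_mono[OF finite_lessThan] by fastforce
  ultimately show ?thesis using that by blast
qed

text \<open>Non-adjacent vertices of \<open>G\<close> may still have a common neighbour. Changing
  the \<open>H\<close>-coordinate as well rules this out: a path with one internal vertex would make
  one move in each factor and so use the missing edge.\<close>

lemma num_colors_product_not_complete:
  assumes "pair_graph G" "\<not> complete_graph G" "finite (pverts H)" "card (pverts H) \<ge> 2"
    and "proper_vertex_k_connected k (G \<box> H) c" "k \<ge> 1"
  shows "2 \<le> num_colors (G \<box> H) c"
proof -
  interpret pair_graph G by fact
  obtain g g' where g: "g \<in> pverts G" "g' \<in> pverts G" "g \<noteq> g'" "(g, g') \<notin> parcs G"
    using assms(1,2) complete_graph_iff by blast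
  obtain h h' where h: "h \<in> pverts H" "h' \<in> pverts H" "h \<noteq> h'"
    using assms(4) by (rule two_elements)
  have "proper_vertex_k_connected 1 (G \<box> H) c"
    using assms(5,6) by (rule proper_vertex_k_connected_mono)
  moreover have "(g, h) \<in> pverts (G \<box> H)" "(g', h') \<in> pverts (G \<box> H)" "(g, h) \<noteq> (g', h')"
    using g h by auto
  ultimately have "\<exists>P. card P = 1 \<and>
      (\<forall>p\<in>P. path_between (G \<box> H) (g, h) p (g', h') \<and> vertex_proper c p)"
    unfolding proper_vertex_k_connected_def by blast
  then obtain p where p: "path_between (G \<box> H) (g, h) p (g', h')" "vertex_proper c p"
    by (auto simp: card_1_singleton_iff)
  have "\<not> length p \<le> 3"
    using path_between_short[OF p(1)] p(1) g h by (auto simp: path_between_iff)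
  thus ?thesis
    using num_colors_ge_2[OF _ p] pair_finite_verts assms(3) by simp
qed

text \<open>The vertices \<open>(a, h)\<close> and \<open>(b, h)\<close> have no common neighbour,
  since a third vertex over \<open>a\<close> or \<open>b\<close> differs from one of them in both
  coordinates. Thus only the edge is short, and a second path has two internal vertices.\<close>

lemma num_colors_product_order_2:
  assumes "finite (pverts H)" "pverts H \<noteq> {}"
    and "\<And>h. (h, h) \<notin> parcs H" "card (pverts G) = 2"
    and "proper_vertex_k_connected 2 (G \<box> H) c"
  shows "2 \<le> num_colors (G \<box> H) c"
proof -
  obtain a b where ab: "pverts G = {a, b}" "a \<noteq> b" using assms(4) by (auto simp: card_2_iff)
  obtain h where h: "h \<in> pverts H" using assms(2) by blast
  have "(a, h) \<in> pverts (G \<box> H)" "(b, h) \<in> pverts (G \<box> H)" "(a, h) \<noteq> (b, h)"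
    using ab h by auto
  then obtain P where P: "card P = 2"
    "\<And>p. p \<in> P \<Longrightarrow> path_between (G \<box> H) (a, h) p (b, h) \<and> vertex_proper c p"
    using assms(5) unfolding proper_vertex_k_connected_def by meson
  \<comment> \<open>Of two distinct paths at least one is not the edge.\<close>
  obtain p where "p \<in> P" "p \<noteq> [(a, h), (b, h)]"
    using P(1) by (metis ex_other order_refl)
  hence p: "path_between (G \<box> H) (a, h) p (b, h)" "vertex_proper c p" "p \<noteq> [(a, h), (b, h)]"
    using P(2) by auto
  have "\<not> length p \<le> 3"
    using path_between_short[OF p(1)] p(1,3) ab assms(3) by (auto simp: path_between_iff)
  thus ?thesis using num_colors_ge_2[OF _ p(1,2)] ab assms(1) by simp
qed

section \<open>Distances in products\<close>

text \<open>Each arc moves a single coordinate and so lowers the sum of the two distances to the end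
  by at most one. Walks are closed under removing the first vertex, which suits the
  induction.\<close>

lemma distance_product_le:
  assumes "pair_graph G" "connected (with_proj G)" "pair_graph H" "connected (with_proj H)"
    and "vwalk p (with_proj (G \<box> H))"
  shows "distance G (fst (hd p)) (fst (last p)) + distance H (snd (hd p)) (snd (last p))
     \<le> length p - 1"
  using assms(5)
proof (induct p rule: induct_list012)
  case (2 u)
  have "vwalk [fst u] (with_proj G)" "vwalk [snd u] (with_proj H)"
    using 2 by (auto simp: vwalk_with_proj_iff)
  from this[THEN distance_le_vwalk] show ?case by simp
next
  case (3 u w q)
  let ?v = "last (w # q)"
  have walk: "vwalk (w # q) (with_proj (G \<box> H))" and uw: "(u, w) \<in> parcs (G \<box> H)"
    using 3(3) by (auto simp: vwalk_with_proj_iff)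
  have "?v \<in> pverts (G \<box> H)"
    using walk last_in_set[of "w # q"] unfolding vwalk_with_proj_iff by blast
  hence v: "fst ?v \<in> pverts G" "snd ?v \<in> pverts H" by auto
  have "distance G (fst u) (fst ?v) + distance H (snd u) (snd ?v) \<le>
      Suc (distance G (fst w) (fst ?v) + distance H (snd w) (snd ?v))"
    using uw distance_Cons_le[OF assms(1,2) _ v(1)] distance_Cons_le[OF assms(3,4) _ v(2)]
    by (cases u, cases w) fastforce
  with 3(2)[OF walk] show ?case by simp
qed (simp add: vwalk_with_proj_iff)

text \<open>By the lower bound, no geodesic can be shorter than a path whose length is the sum of
  the factor distances.\<close>

lemma geodesic_productI:
  assumes "pair_graph G" "connected (with_proj G)" "pair_graph H" "connected (with_proj H)"
    and "path_between (G \<box> H) (g, h) p (g', h')"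
    and "length p - 1 = distance G g g' + distance H h h'"
  shows "geodesic (G \<box> H) (g, h) p (g', h')"
proof -
  obtain q where q: "geodesic (G \<box> H) (g, h) q (g', h')"
    using assms(5) by (rule path_between_imp_geodesic)
  hence "vwalk q (with_proj (G \<box> H))" "hd q = (g, h)" "last q = (g', h')"
    by (auto simp: geodesic_def path_between_def)
  with distance_product_le[OF assms(1-4), of q] have "length p - 1 \<le> length q - 1"
    using assms(6) by simp
  thus ?thesis using q assms(5) distance_le_path[OF assms(5)] by (simp add: geodesic_def)
qed

section \<open>Strong colourings of products\<close>

text \<open>\<open>prod_encode\<close> is an injective pairing into \<open>nat\<close>: two colours
  differ as soon as one component does. Steps in \<open>H\<close> change the second component, steps
  between internal vertices of \<open>P\<close> the first.\<close>

lemma strong_proper_vertex_connected_product: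
  assumes "pair_graph G" "connected (with_proj G)" "pair_graph H" "connected (with_proj H)"
    and c: "strong_proper_vertex_connected G c" and d: "proper_coloring H d"
  shows "strong_proper_vertex_connected (G \<box> H) (\<lambda>(g, h). prod_encode (c g, d h))"
    (is "strong_proper_vertex_connected _ ?f")
  unfolding strong_proper_vertex_connected_def
proof (intro ballI impI)
  fix u v assume uv: "u \<in> pverts (G \<box> H)" "v \<in> pverts (G \<box> H)" "u \<noteq> v"
  obtain g h where u: "u = (g, h)" by (cases u)
  obtain g' h' where v: "v = (g', h')" by (cases v)
  have in_verts: "g \<in> pverts G" "g' \<in> pverts G" "h \<in> pverts H" "h' \<in> pverts H"
    using uv u v by auto
  obtain Q where Q: "geodesic H h Q h'"
    using geodesic_exists[OF assms(3,4) in_verts(3,4)] ..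
  hence Qpath: "path_between H h Q h'" and Qlen: "distance H h h' = length Q - 1" and "Q \<noteq> []"
    by (auto simp: geodesic_def path_between_iff)
  have "successively (\<lambda>x y. d x \<noteq> d y) Q"
    using Qpath d unfolding path_between_iff proper_coloring_def
    by (auto elim!: successively_mono)
  \<comment> \<open>This covers all of \<open>Q\<close>, ends included, because \<open>d\<close> is
    proper on every edge.\<close>
  hence Qcol: "distinct_adj (map (\<lambda>y. ?f (x, y)) Q)" for x
    by (auto simp: distinct_adj_def successively_map elim!: successively_mono)
  show "\<exists>p. geodesic (G \<box> H) u p v \<and> vertex_proper ?f p"
  proof (cases "g = g'")
    case True
    have "path_between G g [g] g" using in_verts by (simp add: path_between_iff)
    from path_between_corner(2)[OF this Qpath]
    have path: "path_between (G \<box> H) u (map (Pair g) Q) v" using True u v by simp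
    have "distance G g g = 0" using distance_le_path[OF \<open>path_between G g [g] g\<close>] by simp
    hence "geodesic (G \<box> H) u (map (Pair g) Q) v"
      using path Qlen True unfolding u v by (intro geodesic_productI[OF assms(1-4)]) auto
    moreover have "vertex_proper ?f (map (Pair g) Q)"
      using Qcol[of g] by (intro vertex_proper_if_distinct_adj) (simp add: comp_def)
    ultimately show ?thesis by blast
  next
    case False
    obtain P where P: "geodesic G g P g'" "vertex_proper c P"
      using c in_verts False unfolding strong_proper_vertex_connected_def by meson
    hence Ppath: "path_between G g P g'" by (simp add: geodesic_def)
    obtain x R where PR: "P = g # x # R" by (rule path_between_nontrivialE[OF Ppath False])
    \<comment> \<open>The copy of \<open>Q\<close> lies over \<open>x\<close>, the second vertex of
      \<open>P\<close>, so the edge from \<open>g\<close> to \<open>x\<close> stays the first edge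
      of the path and \<open>c g\<close> is never compared.\<close>
    let ?q = "map (Pair x) Q @ map (\<lambda>y. (y, h')) R"
    have gx: "(g, x) \<in> parcs G" "g \<notin> set (x # R)" and "path_between G x (x # R) g'"
      using Ppath PR by (auto simp: path_between_iff)
    from path_between_corner(2)[OF this(3) Qpath]
    have q: "path_between (G \<box> H) (x, h) ?q (g', h')" by simp
    have "path_between (G \<box> H) u (u # ?q) v"
      using q gx in_verts u v \<open>Q \<noteq> []\<close>
      unfolding path_between_iff successively_Cons by auto
    moreover have "length (u # ?q) - 1 = distance G g g' + distance H h h'"
      using P(1) PR Qlen \<open>Q \<noteq> []\<close> by (cases Q) (auto simp: geodesic_def)
    ultimately have "geodesic (G \<box> H) u (u # ?q) v"
      unfolding u v by (rule geodesic_productI[OF assms(1-4)])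
    moreover have "vertex_proper ?f (u # ?q)"
    \<comment> \<open>If \<open>R\<close> is empty then \<open>x = g'\<close>, and the last vertex
      of the copy of \<open>Q\<close> is the end of the path; otherwise it is internal and its
      colour must differ from that of the next internal vertex, if any.\<close>
    proof (cases "R = []")
      case True
      have "distinct_adj (butlast (map (\<lambda>y. ?f (x, y)) Q))" by (rule distinct_adj_butlast[OF Qcol])
      thus ?thesis using True
        by (simp add: vertex_proper_def internal_vertices_def map_butlast[symmetric] comp_def)
    next
      case False
      \<comment> \<open>These are exactly the internal vertices of \<open>P\<close>.\<close>
      have "distinct_adj (map c (x # butlast R))"
        using P(2) PR False by (simp add: vertex_proper_def internal_vertices_def)
      hence cR: "distinct_adj (map c (butlast R))" "butlast R \<noteq> [] \<Longrightarrow> c x \<noteq> c (hd (butlast R))"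
        by (auto simp: distinct_adj_Cons hd_map)
      have "distinct_adj (map (\<lambda>y. ?f (y, h')) (butlast R))"
        using cR(1) unfolding distinct_adj_def successively_map
        by (auto elim!: successively_mono)
      thus ?thesis using Qcol[of x] cR(2) False Qpath
        by (auto simp: vertex_proper_def internal_vertices_def butlast_append map_butlast[symmetric]
            distinct_adj_append_iff comp_def last_map hd_map path_between_iff)
    qed
    ultimately show ?thesis by blast
  qed
qed

text \<open>Every colour used codes a pair of a colour of \<open>G\<close> and one of
  \<open>H\<close>, so the bounds multiply.\<close>

lemma ex_strong_coloring_product:
  assumes "pair_graph G" "connected (with_proj G)" "pair_graph H" "connected (with_proj H)"
  obtains f where "strong_proper_vertex_connected (G \<box> H) f"
    "num_colors (G \<box> H) f \<le> max 1 (spvc G) * \<chi> H"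
proof -
  interpret G: pair_graph G by fact
  interpret H: pair_graph H by fact
  obtain c where c: "strong_proper_vertex_connected G c" "num_colors G c \<le> max 1 (spvc G)"
    by (rule ex_strong_coloring[OF assms(1,2)])
  obtain d where d: "proper_coloring H d" "num_colors H d = \<chi> H"
    by (rule ex_chromatic_coloring[OF assms(3)])
  let ?f = "\<lambda>(g, h). prod_encode (c g, d h)"
  have "?f ` pverts (G \<box> H) \<subseteq> prod_encode ` (c ` pverts G \<times> d ` pverts H)" by auto
  hence "num_colors (G \<box> H) ?f \<le> card (prod_encode ` (c ` pverts G \<times> d ` pverts H))"
    unfolding num_colors_def
    using G.pair_finite_verts H.pair_finite_verts by (intro card_mono) auto
  also have "\<dots> \<le> card (c ` pverts G \<times> d ` pverts H)"
    using G.pair_finite_verts H.pair_finite_verts by (intro card_image_le) auto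
  also have "\<dots> = num_colors G c * num_colors H d"
    by (simp add: card_cartesian_product num_colors_def)
  also have "\<dots> \<le> max 1 (spvc G) * \<chi> H" using c(2) d(2) by simp
  finally show ?thesis
    using that strong_proper_vertex_connected_product[OF assms c(1) d(1)] by blast
qed

section \<open>Products of complete graphs\<close>

text \<open>An L-shaped route with at most one edge in each factor has at most
  \<open>2 + 2 - 1\<close> vertices.\<close>

lemma complete_product_short_path:
  assumes "pair_graph G" "pair_graph H" "complete_graph G" "complete_graph H"
    and "u \<in> pverts (G \<box> H)" "v \<in> pverts (G \<box> H)"
  obtains p where "path_between (G \<box> H) u p v" "length p \<le> 3"
proof -
  obtain g h where u: "u = (g, h)" by (cases u)
  obtain g' h' where v: "v = (g', h')" by (cases v)
  have short: "\<exists>p. path_between K x p y \<and> length p \<le> 2"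
    if "pair_graph K" "complete_graph K" "x \<in> pverts K" "y \<in> pverts K"
    for K :: "'c pair_pre_digraph" and x y
  proof (cases "x = y")
    case True
    thus ?thesis using that by (intro exI[of _ "[x]"]) (auto simp: path_between_iff)
  next
    case False
    thus ?thesis using that complete_graph_iff[OF that(1)]
      by (intro exI[of _ "[x, y]"]) (auto simp: path_between_iff)
  qed
  obtain P where P: "path_between G g P g'" "length P \<le> 2"
    using short[OF assms(1,3)] assms(5,6) u v by auto
  obtain Q where Q: "path_between H h Q h'" "length Q \<le> 2"
    using short[OF assms(2,4)] assms(5,6) u v by auto
  show ?thesis
    using that path_between_corner(1)[OF P(1) Q(1)] P(2) Q(2) u v by fastforce
qed

text \<open>Paths on at most three vertices are proper for every colouring, so \<open>c\<close> is
  arbitrary and may be taken constant.\<close>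

lemma complete_product_connected:
  assumes "pair_graph G" "pair_graph H" "complete_graph G" "complete_graph H"
  shows "proper_vertex_k_connected 1 (G \<box> H) c" "strong_proper_vertex_connected (G \<box> H) c"
proof -
  show "proper_vertex_k_connected 1 (G \<box> H) c"
    unfolding proper_vertex_k_connected_def
  proof (intro ballI impI)
    fix u v assume "u \<in> pverts (G \<box> H)" "v \<in> pverts (G \<box> H)"
    from complete_product_short_path[OF assms this] obtain p
      where "path_between (G \<box> H) u p v" "length p \<le> 3" .
    thus "\<exists>P. finite P \<and> card P = 1 \<and> pairwise internally_disjoint P \<and>
        (\<forall>p\<in>P. path_between (G \<box> H) u p v \<and> vertex_proper c p)"
      by (intro exI[of _ "{p}"]) (auto simp: vertex_proper_short)
  qed
  show "strong_proper_vertex_connected (G \<box> H) c"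
    unfolding strong_proper_vertex_connected_def
  proof (intro ballI impI)
    fix u v assume "u \<in> pverts (G \<box> H)" "v \<in> pverts (G \<box> H)"
    from complete_product_short_path[OF assms this] obtain p
      where p: "path_between (G \<box> H) u p v" "length p \<le> 3" .
    \<comment> \<open>The short path need not be a geodesic, but it bounds the length of
      one.\<close>
    obtain q where q: "geodesic (G \<box> H) u q v" using p(1) by (rule path_between_imp_geodesic)
    hence "length q \<le> 3"
      using distance_le_path[OF p(1)] p(2) unfolding geodesic_def vwalk_length_simp by linarith
    thus "\<exists>p. geodesic (G \<box> H) u p v \<and> vertex_proper c p" using q vertex_proper_short by blast
  qed
qed

text \<open>Vertices differing in both coordinates are joined by the two L-shaped routes. Within a
  layer, the edge is paired with a route through a third vertex of the layer, which exists by the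
  order assumption.\<close>

lemma complete_product_2_connected:
  assumes "pair_graph G" "pair_graph H" "complete_graph G" "complete_graph H"
    and "card (pverts G) \<ge> 3" "card (pverts H) \<ge> 3"
  shows "proper_vertex_k_connected 2 (G \<box> H) c"
proof (rule proper_vertex_2_connectedI)
  have edge: "path_between K x [x, y] y"
    if "pair_graph K" "complete_graph K" "x \<in> pverts K" "y \<in> pverts K" "x \<noteq> y"
    for K :: "'c pair_pre_digraph" and x y
    using that complete_graph_iff[OF that(1)] by (auto simp: path_between_iff)
  have third: "\<exists>z\<in>A. z \<noteq> x \<and> z \<noteq> y" if "card A \<ge> 3" for A :: "'c set" and x y
  proof (rule ccontr)
    assume "\<not> ?thesis"
    hence "A \<subseteq> {x, y}" by blast
    from card_mono[OF _ this] card_insert_le_m1[of 2 "{y}" x] that show False by simp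
  qed
  have triangle: "path_between K x [x, z, y] y"
    if "pair_graph K" "complete_graph K" "x \<in> pverts K" "y \<in> pverts K" "z \<in> pverts K"
      "x \<noteq> y" "z \<noteq> x" "z \<noteq> y"
    for K :: "'c pair_pre_digraph" and x y z
    using that complete_graph_iff[OF that(1)] by (auto simp: path_between_iff)
  fix u v assume uv: "u \<in> pverts (G \<box> H)" "v \<in> pverts (G \<box> H)" "u \<noteq> v"
  obtain g h where u: "u = (g, h)" by (cases u)
  obtain g' h' where v: "v = (g', h')" by (cases v)
  have in_verts: "g \<in> pverts G" "g' \<in> pverts G" "h \<in> pverts H" "h' \<in> pverts H"
    using uv u v by auto
  consider "g \<noteq> g'" "h \<noteq> h'" | "g \<noteq> g'" "h = h'" | "g = g'" "h \<noteq> h'" using uv(3) u v by auto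
  hence "\<exists>p q. p \<noteq> q \<and> internally_disjoint p q \<and> path_between (G \<box> H) u p v \<and>
      path_between (G \<box> H) u q v \<and> length p \<le> 3 \<and> length q \<le> 3"
  proof cases
    case 1
    have P: "path_between G g [g, g'] g'" and Q: "path_between H h [h, h'] h'"
      using edge[OF assms(1,3)] edge[OF assms(2,4)] 1 in_verts by auto
    obtain p q where "p \<noteq> q" "internally_disjoint p q"
      "path_between (G \<box> H) (g, h) p (g', h')" "path_between (G \<box> H) (g, h) q (g', h')"
      "length p = 3" "length q = 3"
      by (rule two_paths_diagonal[OF P 1(1) Q 1(2)]) auto
    thus ?thesis unfolding u v by (metis order_refl)
  next
    case 2
    obtain k where k: "k \<in> pverts G" "k \<noteq> g" "k \<noteq> g'" using third[OF assms(5)] by metis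
    have "path_between G g [g, g'] g'" "path_between G g [g, k, g'] g'"
      using edge[OF assms(1,3)] triangle[OF assms(1,3)] 2 k in_verts by auto
    from this[THEN path_between_horizontal, of h H] 2 in_verts show ?thesis unfolding u v
      by (intro exI[of _ "[(g, h), (g', h)]"] exI[of _ "[(g, h), (k, h), (g', h)]"])
        (auto simp: internally_disjoint_def internal_vertices_def)
  next
    case 3
    obtain k where k: "k \<in> pverts H" "k \<noteq> h" "k \<noteq> h'" using third[OF assms(6)] by metis
    have "path_between H h [h, h'] h'" "path_between H h [h, k, h'] h'"
      using edge[OF assms(2,4)] triangle[OF assms(2,4)] 3 k in_verts by auto
    \<comment> \<open>The two paths are horizontal in \<open>H \<box> G\<close> and are carried over
      by the swap.\<close>
    from this[THEN path_between_horizontal, THEN path_between_swap, of g G] 3 in_verts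
    show ?thesis unfolding u v
      by (intro exI[of _ "[(g, h), (g, h')]"] exI[of _ "[(g, h), (g, k), (g, h')]"])
        (auto simp: internally_disjoint_def internal_vertices_def)
  qed
  thus "\<exists>p q. p \<noteq> q \<and> internally_disjoint p q \<and> path_between (G \<box> H) u p v \<and>
      path_between (G \<box> H) u q v \<and> vertex_proper c p \<and> vertex_proper c q"
    using vertex_proper_short by blast
qed

section \<open>Combining the colourings with the lower bounds\<close>

theorem theorem3p2:
  fixes G :: "'a pair_pre_digraph" and H :: "'b pair_pre_digraph"
  assumes "pair_graph G" and "connected (with_proj G)" and "card (pverts G) \<ge> 2"
    and "pair_graph H" and "connected (with_proj H)" and "card (pverts H) \<ge> 2"
  shows "(if complete_graph G \<and> complete_graph H
          then pvc (G \<box> H) = 1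
          else pvc (G \<box> H) = 2)
    \<and> (if complete_graph G \<and> card (pverts G) \<ge> 3 \<and> complete_graph H \<and> card (pverts H) \<ge> 3
       then pvc_k 2 (G \<box> H) = 1
       else pvc_k 2 (G \<box> H) = 2)
    \<and> (if complete_graph G \<and> complete_graph H
       then spvc (G \<box> H) = 1
       else spvc (G \<box> H) \<le>
              min (max 1 (spvc G) * \<chi> H) (max 1 (spvc H) * \<chi> G))"
proof -
  interpret G: pair_graph G by fact
  interpret H: pair_graph H by fact
  have fin: "finite (pverts (G \<box> H))" and ne: "pverts (G \<box> H) \<noteq> {}"
    using G.pair_finite_verts H.pair_finite_verts assms(3,6) by auto
  have const: "num_colors (G \<box> H) (\<lambda>_. 0) = 1"
    using ne by (simp add: num_colors_def image_constant_conv)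
  have not_complete: "\<not> complete_graph (G \<box> H)" by (rule product_not_complete[OF assms(3,6)])
  obtain c where c: "proper_vertex_k_connected 2 (G \<box> H) c" "num_colors (G \<box> H) c \<le> 2"
    by (rule ex_proper_2_coloring_product[OF assms])
  \<comment> \<open>Keeping \<open>k\<close> general serves both \<open>pvc\<close> and
    \<open>pvc_k 2\<close>; if \<open>H\<close> is the factor that is not complete, the colouring is
    swapped.\<close>
  have lower: "2 \<le> num_colors (G \<box> H) c"
    if "\<not> (complete_graph G \<and> complete_graph H)" "k \<ge> 1" "proper_vertex_k_connected k (G \<box> H) c"
    for k c
  proof (cases "complete_graph G")
    case True
    hence "\<not> complete_graph H" using that(1) by blast
    from num_colors_product_not_complete[OF assms(4) this G.pair_finite_verts assms(3)
        proper_vertex_k_connected_swap[OF that(3)] that(2)]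
    show ?thesis by (simp add: num_colors_swap)
  next
    case False
    from num_colors_product_not_complete[OF assms(1) this H.pair_finite_verts assms(6) that(3,2)]
    show ?thesis .
  qed
  have lower2: "2 \<le> num_colors (G \<box> H) c"
    if small: "\<not> (complete_graph G \<and> card (pverts G) \<ge> 3 \<and> complete_graph H \<and> card (pverts H) \<ge> 3)"
      and c: "proper_vertex_k_connected 2 (G \<box> H) c" for c
  proof -
    have loopfree: "(g, g) \<notin> parcs G" "(h, h) \<notin> parcs H" for g h
      using G.pair_no_loops H.pair_no_loops by fastforce+
    \<comment> \<open>Orders are at least 2, so an order below 3 equals 2.\<close>
    consider "\<not> (complete_graph G \<and> complete_graph H)" | "card (pverts G) = 2" | "card (pverts H) = 2"
      using small assms(3,6) by linarith
    thus ?thesis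
    proof cases
      case 1
      thus ?thesis using lower[of 2] c by simp
    next
      case 2
      show ?thesis
        using num_colors_product_order_2[OF H.pair_finite_verts _ loopfree(2) 2 c] ne by auto
    next
      case 3
      show ?thesis
        using num_colors_product_order_2[OF G.pair_finite_verts _ loopfree(1) 3
            proper_vertex_k_connected_swap[OF c]] ne by (auto simp: num_colors_swap)
    qed
  qed
  note pos = num_colors_pos[OF fin ne]
  have "pvc (G \<box> H) = 1" if "complete_graph G" "complete_graph H"
    unfolding pvc_def using not_complete const pos complete_product_connected(1)[OF assms(1,4) that]
    by (intro pvc_k_eqI[where c = "\<lambda>_. 0"]) auto
  moreover have "pvc (G \<box> H) = 2" if "\<not> (complete_graph G \<and> complete_graph H)"
    \<comment> \<open>The two-colouring obtained for pairs of disjoint paths is reused here by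
      monotonicity in \<open>k\<close>.\<close>
    unfolding pvc_def using not_complete c lower[OF that, of 1] proper_vertex_k_connected_mono[OF c(1)]
    by (intro pvc_k_eqI[where c = c]) auto
  moreover have "pvc_k 2 (G \<box> H) = 1"
    if "complete_graph G" "card (pverts G) \<ge> 3" "complete_graph H" "card (pverts H) \<ge> 3"
    using const pos complete_product_2_connected[OF assms(1,4)] that
    by (intro pvc_k_eqI[where c = "\<lambda>_. 0"]) auto
  moreover have "pvc_k 2 (G \<box> H) = 2"
    if "\<not> (complete_graph G \<and> card (pverts G) \<ge> 3 \<and> complete_graph H \<and> card (pverts H) \<ge> 3)"
    using c lower2[OF that] by (intro pvc_k_eqI[where c = c]) auto
  moreover have "spvc (G \<box> H) = 1" if "complete_graph G" "complete_graph H"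
  proof -
    have "strong_proper_vertex_connected (G \<box> H) (\<lambda>_. 0)"
      by (rule complete_product_connected(2)[OF assms(1,4) that])
    hence "(LEAST n. \<exists>c. strong_proper_vertex_connected (G \<box> H) c \<and> num_colors (G \<box> H) c = n) = 1"
      using const pos by (intro Least_equality) auto
    thus ?thesis using not_complete by (simp add: spvc_def)
  qed
  \<comment> \<open>Both bounds are shown without a case distinction: \<open>max 1\<close> keeps
    them valid when a factor is complete.\<close>
  moreover have "spvc (G \<box> H) \<le> max 1 (spvc G) * \<chi> H"
    using ex_strong_coloring_product[OF assms(1,2,4,5)] spvc_le order_trans by metis
  moreover have "spvc (G \<box> H) \<le> max 1 (spvc H) * \<chi> G"
  proof -
    obtain f where f: "strong_proper_vertex_connected (H \<box> G) f"
      "num_colors (H \<box> G) f \<le> max 1 (spvc H) * \<chi> G"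
      by (rule ex_strong_coloring_product[OF assms(4,5,1,2)])
    from spvc_le[OF strong_proper_vertex_connected_swap[OF f(1)]] f(2) show ?thesis
      by (simp add: num_colors_swap)
  qed
  ultimately show ?thesis by (auto simp only: min.bounded_iff split: if_split)
qed

end
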